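(* Let $n\ge1$, $\delta>0$ and $n<\beta<n+4$. Let $f\in H^{s_1}(\mathbf{T}^n)$ and $g\in H^{s_2}(\mathbf{T}^n)$ with $s_1\ge0$, $s_2\ge0$. Suppose that there exists $p\in\mathbb{Z}_{\ge0}$ such that $s_1>n+p\frac{\beta-n}{2}$ and $s_2>n+(p-1)\frac{\beta-n}{2}$. Let $$u(x,t)=(\hat f_0+\hat g_0t)+\sum_{0\ne k\in\mathbb{Z}^n}\left[\hat f_k\cos(\sqrt{-m_k}\,t)+\frac{\hat g_k}{\sqrt{-m_k}}\sin(\sqrt{-m_k}\,t)\right]e^{ik\cdot x}.$$ Then $u(x,\cdot)\in C^p[0,\infty)$ (in the sense of classical derivatives in $t$) for any $x\in\mathbf{T}^n$.
   Context: For $k\in\mathbb{Z}^n$, $m_k=m^{\delta,\beta}(k)$, where for $\nu\in\mathbb{R}^n$ $$m^{\delta,\beta}(\nu)=-\|\nu\|^2\,{}_2F_3\!\left(1,\tfrac{n+2-\beta}{2};2,\tfrac{n+2}{2},\tfrac{n+4-\beta}{2};-\tfrac14\|\nu\|^2\delta^2\right),$$ ${}_2F_3(a_1,a_2;b_1,b_2,b_3;z)=\sum_{j\ge0}\frac{(a_1)_j(a_2)_j}{(b_1)_j(b_2)_j(b_3)_j}\frac{z^j}{j!}$, $(a)_j=a(a+1)\cdots(a+j-1)$; for $\beta<n+4$ one has $m_k<0$ for all $k\neq0$. $\mathbf{T}^n=\prod_{j=1}^n[0,2\pi]$ is the periodic torus; a periodic distribution $g$ is written $g=\sum_{k\in\mathbb{Z}^n}\hat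 g_ke^{ik\cdot x}$ with Fourier coefficients $\hat g_k$; for $q\in\mathbb{R}$, $H^q(\mathbf{T}^n)$ is the space of periodic distributions with $\sum_{k\in\mathbb{Z}^n}(1+\|k\|^2)^q|\hat g_k|^2<\infty$. *)

theory Defs
  imports "HOL-Analysis.Analysis"
begin

definition hypergeom_2F3 :: "real \<Rightarrow> real \<Rightarrow> real \<Rightarrow> real \<Rightarrow> real \<Rightarrow> real \<Rightarrow> real" where
  "hypergeom_2F3 a1 a2 b1 b2 b3 z =
     (\<Sum>j. (pochhammer a1 j * pochhammer a2 j) /
            (pochhammer b1 j * pochhammer b2 j * pochhammer b3 j) * (z ^ j / fact j))"

definition multiplier :: "real \<Rightarrow> real \<Rightarrow> real ^ 'n::finite \<Rightarrow> real" where
  "multiplier \<delta> \<beta> \<nu> =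
     - (norm \<nu>)\<^sup>2 *
       hypergeom_2F3 1 ((real CARD('n) + 2 - \<beta>) / 2)
         2 ((real CARD('n) + 2) / 2) ((real CARD('n) + 4 - \<beta>) / 2)
         (- (1 / 4) * (norm \<nu>)\<^sup>2 * \<delta>\<^sup>2)"

definition real_vec :: "int ^ 'n \<Rightarrow> real ^ 'n" where
  "real_vec k = (\<chi> i. real_of_int (k $ i))"

definition torus :: "(real ^ 'n) set" where
  "torus = {x. \<forall>i. 0 \<le> x $ i \<and> x $ i \<le> 2 * pi}"

definition fourier_mode :: "int ^ 'n::finite \<Rightarrow> real ^ 'n \<Rightarrow> complex" where
  "fourier_mode k x = exp (\<i> * complex_of_real (real_vec k \<bullet> x))"

text \<open>Iterated partial derivatives; the list gives the directions, its last entry being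
  the first one differentiated along.\<close>

fun partial_derivs :: "'n list \<Rightarrow> (real ^ 'n::finite \<Rightarrow> complex) \<Rightarrow> real ^ 'n \<Rightarrow> complex" where
  "partial_derivs [] \<phi> = \<phi>"
| "partial_derivs (i # js) \<phi> =
     (\<lambda>x. vector_derivative (\<lambda>h. partial_derivs js \<phi> (x + h *\<^sub>R axis i 1)) (at 0))"

text \<open>The test functions are the smooth functions that are \<open>2\<pi>\<close>-periodic in every coordinate.\<close>

definition test_functions :: "(real ^ 'n::finite \<Rightarrow> complex) set" where
  "test_functions =
     {\<phi>. (\<forall>js x. partial_derivs js \<phi> differentiable (at x)) \<and>
         (\<forall>i x. \<phi> (x + (2 * pi) *\<^sub>R axis i 1) = \<phi> x)}"

text \<open>Periodic distributions are the continuous linear functionals on the test functions, with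
  continuity expressed through the seminorms that define the Frechet topology. Only the values
  on test functions are meaningful.\<close>

definition periodic_distribution :: "((real ^ 'n::finite \<Rightarrow> complex) \<Rightarrow> complex) \<Rightarrow> bool" where
  "periodic_distribution g \<longleftrightarrow>
     (\<forall>\<phi>\<in>test_functions. \<forall>\<psi>\<in>test_functions. g (\<lambda>x. \<phi> x + \<psi> x) = g \<phi> + g \<psi>) \<and>
     (\<forall>c. \<forall>\<phi>\<in>test_functions. g (\<lambda>x. c * \<phi> x) = c * g \<phi>) \<and>
     (\<exists>C N. \<forall>\<phi>\<in>test_functions.
        norm (g \<phi>) \<le> C * (\<Sum>js | length js \<le> N. SUP x\<in>torus. norm (partial_derivs js \<phi> x)))"

text \<open>Normalised so that an integrable function, acting by \<open>\<phi> \<mapsto> \<integral> g \<phi>\<close> over the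
  torus, has the coefficients of its expansion in the functions \<^const>\<open>fourier_mode\<close>.\<close>

definition fourier_coeff ::
    "((real ^ 'n::finite \<Rightarrow> complex) \<Rightarrow> complex) \<Rightarrow> int ^ 'n \<Rightarrow> complex" where
  "fourier_coeff g k = g (fourier_mode (- k)) / complex_of_real ((2 * pi) ^ CARD('n))"

definition sobolev_torus :: "real \<Rightarrow> ((real ^ 'n::finite \<Rightarrow> complex) \<Rightarrow> complex) set" where
  "sobolev_torus q =
     {g. periodic_distribution g \<and>
         (\<lambda>k. (1 + (norm (real_vec k))\<^sup>2) powr q * (norm (fourier_coeff g k))\<^sup>2)
           summable_on UNIV}"

definition wave_term ::
    "real \<Rightarrow> real \<Rightarrow> ((real ^ 'n::finite \<Rightarrow> complex) \<Rightarrow> complex) \<Rightarrow>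
     ((real ^ 'n \<Rightarrow> complex) \<Rightarrow> complex) \<Rightarrow> real ^ 'n \<Rightarrow> real \<Rightarrow> int ^ 'n \<Rightarrow> complex" where
  "wave_term \<delta> \<beta> f g x t k =
     (let \<omega> = sqrt (- multiplier \<delta> \<beta> (real_vec k)) in
       (fourier_coeff f k * complex_of_real (cos (\<omega> * t)) +
        fourier_coeff g k / complex_of_real \<omega> * complex_of_real (sin (\<omega> * t))) *
       fourier_mode k x)"

definition wave_solution ::
    "real \<Rightarrow> real \<Rightarrow> ((real ^ 'n::finite \<Rightarrow> complex) \<Rightarrow> complex) \<Rightarrow>
     ((real ^ 'n \<Rightarrow> complex) \<Rightarrow> complex) \<Rightarrow> real ^ 'n \<Rightarrow> real \<Rightarrow> complex" where
  "wave_solution \<delta> \<beta> f g x t =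
     (fourier_coeff f 0 + fourier_coeff g 0 * complex_of_real t) +
     (\<Sum>\<^sub>\<infinity>k\<in>- {0}. wave_term \<delta> \<beta> f g x t k)"

text \<open>\<open>p\<close> times continuously differentiable on \<open>S\<close>: \<open>D j\<close> is the \<open>j\<close>-th derivative, which is
  one-sided at boundary points of \<open>S\<close>.\<close>

definition C_k_on :: "nat \<Rightarrow> (real \<Rightarrow> complex) \<Rightarrow> real set \<Rightarrow> bool" where
  "C_k_on p h S \<longleftrightarrow>
     (\<exists>D. D 0 = h \<and>
          (\<forall>j<p. \<forall>t\<in>S. (D j has_vector_derivative D (Suc j) t) (at t within S)) \<and>
          (\<forall>j\<le>p. continuous_on S (D j)))"

end

(*
  With \<alpha> = (\<beta> - n) / 2, a = 1 - \<alpha> and c = n / 2, the value -m(\<nu>) is, up to the factor 4 / \<delta>^2,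
  P(y) = y 2F3(1, a; 2, c + 1, a + 1; -y) at y = |\<nu>|^2 \<delta>^2 / 4.  The series P solves
  y P' - \<alpha> P = a c (1 - \<phi>), where \<phi> = 0F1(c; -y) is a normalised Bessel function with
  1 - y / c \<le> \<phi> \<le> 1, so monotonicity of corrected versions of y^(-\<alpha>) P traps P between
  multiples of y^\<alpha>.  Hence the frequencies grow exactly like |k|^\<alpha>, and the p-fold
  termwise differentiated series has a majorant independent of t, whose sum converges by
  Cauchy-Schwarz because (1 + |k|^2)^(-n) is summable over the lattice.
*)
theory Submission
  imports Defs
begin

section \<open>The normalised Bessel function: power series, differential equation and
  bounds\<close>

definition bessel_coeff :: "real \<Rightarrow> nat \<Rightarrow> real" where
  "bessel_coeff c l = (- 1) ^ l / (pochhammer c l * fact l)"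

text \<open>For positive \<open>c\<close> and \<open>y\<close> this is Gamma(c) y^((1-c)/2)
  J_{c-1}(2 sqrt y); at \<open>c = 1/2\<close> it is cos(2 sqrt y).\<close>

definition bessel_series :: "real \<Rightarrow> real \<Rightarrow> real" where
  "bessel_series c y = (\<Sum>l. bessel_coeff c l * y ^ l)"

text \<open>Coefficient quotients of order 1/l beat any fixed \<open>y\<close>. The bound is asked
  only from index 1 because for \<open>hyp_coeff\<close> the first quotient violates it when
  \<open>a\<close> is close to -1.\<close>

lemma summable_entire_ratio:
  fixes u :: "nat \<Rightarrow> real"
  assumes "c > 0" "\<And>l. l \<ge> 1 \<Longrightarrow> \<bar>u (Suc l)\<bar> \<le> \<bar>u l\<bar> / (c * real (Suc l))"
  shows "summable (\<lambda>l. u l * y ^ l)"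
proof (rule summable_ratio_test[where c = "1/2" and N = "max 1 (nat \<lceil>2 * \<bar>y\<bar> / c\<rceil>)"])
  fix l assume l: "l \<ge> max 1 (nat \<lceil>2 * \<bar>y\<bar> / c\<rceil>)"
  then have "2 * \<bar>y\<bar> / c \<le> real l"
    by linarith
  with \<open>c > 0\<close> have y: "\<bar>y\<bar> / (c * real (Suc l)) \<le> 1 / 2"
    by (simp add: field_simps)
  have "norm (u (Suc l) * y ^ Suc l) = \<bar>u (Suc l)\<bar> * \<bar>y\<bar> ^ Suc l"
    by (simp add: abs_mult power_abs)
  also have "\<dots> \<le> \<bar>u l\<bar> / (c * real (Suc l)) * \<bar>y\<bar> ^ Suc l"
    using assms(2)[of l] l by (intro mult_right_mono) auto
  also have "\<dots> = \<bar>y\<bar> / (c * real (Suc l)) * (\<bar>u l\<bar> * \<bar>y\<bar> ^ l)"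
    by simp
  also have "\<dots> \<le> 1 / 2 * (\<bar>u l\<bar> * \<bar>y\<bar> ^ l)"
    using y by (intro mult_right_mono) auto
  finally show "norm (u (Suc l) * y ^ Suc l) \<le> 1 / 2 * norm (u l * y ^ l)"
    by (simp add: abs_mult power_abs)
qed simp

lemma summable_bessel:
  assumes "c > 0"
  shows "summable (\<lambda>l. bessel_coeff c l * y ^ l)"
proof (rule summable_entire_ratio[OF assms])
  fix l :: nat
  have p: "pochhammer c l > 0"
    using assms by (rule pochhammer_pos)
  have "\<bar>bessel_coeff c (Suc l)\<bar> = \<bar>bessel_coeff c l\<bar> / ((c + real l) * real (Suc l))"
    using p assms by (simp add: bessel_coeff_def pochhammer_Suc abs_mult field_simps)
  also have "\<dots> \<le> \<bar>bessel_coeff c l\<bar> / (c * real (Suc l))"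
    using assms by (intro divide_left_mono mult_right_mono mult_pos_pos) auto
  finally show "\<bar>bessel_coeff c (Suc l)\<bar> \<le> \<bar>bessel_coeff c l\<bar> / (c * real (Suc l))" .
qed

lemma bessel_series_0 [simp]: "bessel_series c 0 = 1"
  using powser_zero[of "bessel_coeff c"] by (simp add: bessel_series_def bessel_coeff_def)

lemma DERIV_bessel_series:
  assumes "c > 0"
  shows "(bessel_series c has_real_derivative - bessel_series (c + 1) y / c) (at y)"
proof -
  have d: "diffs (bessel_coeff c) l = - (1 / c) * bessel_coeff (c + 1) l" for l
  proof -
    have "real (Suc l) / fact (Suc l) = 1 / fact l"
      by (simp del: of_nat_Suc)
    then have "diffs (bessel_coeff c) l = (- 1) ^ Suc l / pochhammer c (Suc l) * (1 / fact l)"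
      unfolding diffs_def bessel_coeff_def by (metis of_nat_id divide_divide_eq_left' mult.commute times_divide_eq_right)
    then show ?thesis
      by (simp add: bessel_coeff_def pochhammer_rec[of c])
  qed
  have "(bessel_series c has_real_derivative (\<Sum>l. diffs (bessel_coeff c) l * y ^ l)) (at y)"
    unfolding bessel_series_def[abs_def]
    by (rule termdiffs_strong_converges_everywhere) (rule summable_bessel[OF assms])
  also have "(\<Sum>l. diffs (bessel_coeff c) l * y ^ l)
      = (\<Sum>l. - (1 / c) * (bessel_coeff (c + 1) l * y ^ l))"
    by (simp add: d mult.assoc)
  also have "\<dots> = - (1 / c) * bessel_series (c + 1) y"
    unfolding bessel_series_def using assms by (intro suminf_mult summable_bessel) auto
  finally show ?thesis
    by simp
qed

text \<open>Since \<phi>' = - \<open>bessel_series (c + 1)\<close> / c and \<phi>'' =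
  \<open>bessel_series (c + 2)\<close> / (c (c + 1)), this is the equation y \<phi>'' + c \<phi>' +
  \<phi> = 0. On coefficients it rests on 1/(c)_l - 1/(c+1)_l = l/(c)_{l+1}, whose factor l vanishes
  at l = 0 and otherwise lowers the factorial by one index.\<close>

lemma bessel_contiguous:
  assumes "c > 0"
  shows "y * bessel_series (c + 2) y / (c * (c + 1)) = bessel_series (c + 1) y - bessel_series c y"
proof -
  define d where "d l = bessel_coeff (c + 1) l - bessel_coeff c l" for l
  have d0: "d 0 = 0"
    by (simp add: d_def bessel_coeff_def)
  have dS: "d (Suc m) = bessel_coeff (c + 2) m / (c * (c + 1))" for m
  proof -
    define q where "q = pochhammer (c + 2) m"
    define s :: real where "s = (- 1) ^ m"
    have q: "q > 0"
      using assms by (auto simp: q_def intro!: pochhammer_pos)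
    have 1: "pochhammer c (Suc m) = c * ((c + 1) * q) / (c + 1 + real m)"
      "pochhammer (c + 1) (Suc m) = (c + 1) * q"
      using assms pochhammer_rec[of c "Suc m"] pochhammer_rec[of "c+1" m] pochhammer_Suc[of c "Suc m"]
      by (simp_all add: q_def add.commute add.left_commute eq_divide_eq)
    have "d (Suc m) = s / fact (Suc m) * (1 / pochhammer c (Suc m) - 1 / pochhammer (c + 1) (Suc m))"
      by (simp add: d_def bessel_coeff_def s_def right_diff_distrib divide_simps)
    also have "1 / pochhammer c (Suc m) - 1 / pochhammer (c + 1) (Suc m) = real (Suc m) / (c * (c + 1) * q)"
      unfolding 1 using assms q by (simp add: divide_simps)
    finally show ?thesis
      using q assms by (simp add: bessel_coeff_def del: of_nat_Suc flip: q_def s_def)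
  qed
  have sm: "summable (\<lambda>l. bessel_coeff (c + 1) l * y ^ l)" "summable (\<lambda>l. bessel_coeff c l * y ^ l)"
    "summable (\<lambda>l. bessel_coeff (c + 2) l * y ^ l)"
    using assms by (auto intro: summable_bessel)
  have ds: "summable (\<lambda>l. d l * y ^ l)"
    using summable_diff[OF sm(1,2)] by (simp add: d_def left_diff_distrib)
  have "bessel_series (c + 1) y - bessel_series c y = (\<Sum>l. d l * y ^ l)"
    unfolding bessel_series_def using suminf_diff[OF sm(1,2)] by (simp add: d_def left_diff_distrib)
  also have "\<dots> = (\<Sum>l. d (Suc l) * y ^ Suc l)"
    using suminf_split_head[OF ds] d0 by simp
  also have "\<dots> = (\<Sum>l. y / (c * (c + 1)) * (bessel_coeff (c + 2) l * y ^ l))"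
    by (simp add: dS mult_ac)
  also have "\<dots> = y / (c * (c + 1)) * bessel_series (c + 2) y"
    unfolding bessel_series_def by (rule suminf_mult[OF sm(3)])
  finally show ?thesis
    by simp
qed

text \<open>The energy \<open>\<phi>\<^sup>2 + y \<phi>'\<^sup>2\<close> of a solution of \<open>y \<phi>'' + c \<phi>' + \<phi> = 0\<close> has derivative
  \<open>(1 - 2 c) \<phi>'\<^sup>2\<close>.\<close>

lemma bessel_series_bound:
  assumes "c \<ge> 1 / 2" "y \<ge> 0"
  shows "\<bar>bessel_series c y\<bar> \<le> 1"
proof -
  have c: "c > 0"
    using assms by simp
  define E where "E x = (bessel_series c x)\<^sup>2 + x * (bessel_series (c + 1) x / c)\<^sup>2" for x
  have "E y \<le> E 0"
  proof (rule DERIV_nonpos_imp_nonincreasing[OF assms(2)])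
    fix x :: real assume x: "0 \<le> x"
    \<comment> \<open>In terms of \<phi> these are \<open>u\<close> = \<phi>, \<open>v\<close> =
      -\<phi>' and \<open>w\<close> = \<phi>''.\<close>
    define u v w where "u = bessel_series c x" "v = bessel_series (c + 1) x / c"
      "w = bessel_series (c + 2) x / (c * (c + 1))"
    have d1: "(bessel_series c has_real_derivative - v) (at x)"
      using DERIV_bessel_series[OF c] by (simp add: u_v_w_def)
    have "(bessel_series (c + 1) has_real_derivative - bessel_series (c + 1 + 1) x / (c + 1)) (at x)"
      using c by (intro DERIV_bessel_series) auto
    then have "(bessel_series (c + 1) has_real_derivative - (c * w)) (at x)"
      using c by (simp add: u_v_w_def add.assoc)
    then have d2: "((\<lambda>x. bessel_series (c + 1) x / c) has_real_derivative - w) (at x)"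
      using c by (auto intro!: derivative_eq_intros)
    have ode: "x * w = c * v - u"
      using bessel_contiguous[OF c, of x] c by (simp add: u_v_w_def)
    have "((\<lambda>x. (bessel_series c x)\<^sup>2 + x * (bessel_series (c + 1) x / c)\<^sup>2) has_real_derivative (2 * u * (- v) + (v\<^sup>2 + x * (2 * v * (- w))))) (at x)"
      using DERIV_add[OF DERIV_power[OF d1, of 2] DERIV_mult[OF DERIV_ident DERIV_power[OF d2, of 2]]]
      by (rule DERIV_cong) (simp add: u_v_w_def mult_ac)
    also have "2 * u * (- v) + (v\<^sup>2 + x * (2 * v * (- w))) = v\<^sup>2 - 2 * v * u - 2 * v * (x * w)"
      by (simp add: algebra_simps)
    also have "\<dots> = (1 - 2 * c) * v\<^sup>2"
      unfolding ode by (simp add: algebra_simps power2_eq_square)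
    finally show "\<exists>D. (E has_real_derivative D) (at x) \<and> D \<le> 0"
      using assms unfolding E_def by (auto intro!: exI mult_nonpos_nonneg)
  qed
  then have "(bessel_series c y)\<^sup>2 + y * (bessel_series (c + 1) y / c)\<^sup>2 \<le> 1"
    by (simp add: E_def)
  moreover have "y * (bessel_series (c + 1) y / c)\<^sup>2 \<ge> 0"
    using assms by simp
  ultimately have "(bessel_series c y)\<^sup>2 \<le> 1"
    by linarith
  then show ?thesis
    by (simp add: abs_square_le_1)
qed

text \<open>The slope - \<open>bessel_series (c + 1)\<close> / c is at least -1/c by
  \<open>bessel_series_bound\<close> for the parameter \<open>c + 1\<close>, and the value at 0 is
  1.\<close>

lemma bessel_series_ge:
  assumes "c \<ge> 1 / 2" "y \<ge> 0"
  shows "bessel_series c y \<ge> 1 - y / c"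
proof -
  have c: "c > 0"
    using assms by simp
  have "bessel_series c 0 + 0 / c \<le> bessel_series c y + y / c"
  proof (rule DERIV_nonneg_imp_nondecreasing[OF assms(2)])
    fix x :: real assume x: "0 \<le> x"
    have "((\<lambda>x. bessel_series c x + x / c) has_real_derivative
        - bessel_series (c + 1) x / c + 1 / c) (at x)"
      by (intro DERIV_add DERIV_bessel_series c) (use c in \<open>auto intro!: derivative_eq_intros\<close>)
    moreover have "- bessel_series (c + 1) x / c + 1 / c \<ge> 0"
      using bessel_series_bound[of "c + 1" x] assms x c by (simp add: field_simps)
    ultimately show "\<exists>D. ((\<lambda>x. bessel_series c x + x / c) has_real_derivative D) (at x) \<and> D \<ge> 0"
      by blast
  qed
  then show ?thesis
    by simp
qed

section \<open>The 2F3 series and its first-order differential equation\<close>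

definition hyp_coeff :: "real \<Rightarrow> real \<Rightarrow> nat \<Rightarrow> real" where
  "hyp_coeff a c j = (- 1) ^ j * (pochhammer 1 j * pochhammer a j) /
     (pochhammer 2 j * pochhammer (c + 1) j * pochhammer (a + 1) j * fact j)"

lemma hypergeom_hyp_coeff:
  "hypergeom_2F3 1 a 2 (c + 1) (a + 1) (- y) = (\<Sum>j. hyp_coeff a c j * y ^ j)"
  unfolding hypergeom_2F3_def hyp_coeff_def
  by (intro suminf_cong) (simp add: power_minus[of y] mult_ac)

text \<open>The quotient (a)_j / (a+1)_j is a / (a+j), so the factor a + j removes all dependence on
  \<open>a\<close> except a constant. Moreover (1)_j cancels j!, (2)_j is (j+1)!, and (c+1)_j is
  (c)_{j+1} / c, which leaves the Bessel coefficient of index j + 1.\<close>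

lemma hyp_coeff_bessel:
  assumes "c > 0" "a > - 1"
  shows "(a + real j) * hyp_coeff a c j = - a * c * bessel_coeff c (Suc j)"
proof -
  have p: "pochhammer (a + 1) j > 0" "pochhammer (c + 1) j > 0"
    using assms by (auto intro!: pochhammer_pos)
  have 1: "(a + real j) * pochhammer a j = a * pochhammer (a + 1) j"
    using pochhammer_rec[of a j] pochhammer_Suc[of a j] by (simp add: mult_ac)
  have 2: "pochhammer 2 j = (fact (Suc j) :: real)"
    using pochhammer_rec[of "1::real" j] pochhammer_fact[of "Suc j", where 'a = real] by simp
  have "(a + real j) * hyp_coeff a c j = (- 1) ^ j * ((a + real j) * pochhammer a j) /
     (fact (Suc j) * pochhammer (c + 1) j * pochhammer (a + 1) j)"
    by (simp add: hyp_coeff_def 2 pochhammer_fact[symmetric] mult.left_commute del: fact_Suc)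
  also have "\<dots> = - a * c * bessel_coeff c (Suc j)"
    unfolding 1 using p assms
    by (simp add: bessel_coeff_def pochhammer_rec[of c] divide_simps del: fact_Suc)
  finally show ?thesis .
qed

lemma summable_hyp:
  assumes "c > 0" "a > - 1"
  shows "summable (\<lambda>j. hyp_coeff a c j * y ^ j)"
proof (rule summable_entire_ratio)
  show "c + 1 > 0"
    using assms by simp
  fix l :: nat assume l: "l \<ge> 1"
  have p: "pochhammer (a + 1) l > 0" "pochhammer (c + 1) l > 0" "pochhammer (2::real) l > 0"
    using assms by (auto intro!: pochhammer_pos)
  have a: "\<bar>a + real l\<bar> \<le> a + 1 + real l" "a + 1 + real l > 0"
    using assms l by linarith+
  \<comment> \<open>The coefficient quotient is \<open>r\<close> / ((c + 1 + l) (l + 1)). For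
    \<open>l \<ge> 1\<close> the number a + l is positive, which gives
    \<open>r \<le> 1\<close>.\<close>
  define r where "r = (1 + real l) * \<bar>a + real l\<bar> / ((2 + real l) * (a + 1 + real l))"
  have "\<bar>hyp_coeff a c (Suc l)\<bar> = \<bar>hyp_coeff a c l\<bar> * r / ((c + 1 + real l) * real (Suc l))"
    using p assms a unfolding hyp_coeff_def r_def
    by (simp add: pochhammer_Suc abs_mult abs_divide del: of_nat_Suc)
       (simp add: divide_simps abs_mult)
  also have "\<dots> \<le> \<bar>hyp_coeff a c l\<bar> * 1 / ((c + 1) * real (Suc l))"
  proof -
    have "r \<le> 1"
      unfolding r_def using a by (subst divide_le_eq_1_pos) (auto intro!: mult_mono)
    moreover have "r \<ge> 0"
      unfolding r_def using a by auto
    ultimately show ?thesis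
      using assms by (intro frac_le mult_left_mono mult_right_mono mult_nonneg_nonneg mult_pos_pos) auto
  qed
  finally show "\<bar>hyp_coeff a c (Suc l)\<bar> \<le> \<bar>hyp_coeff a c l\<bar> / ((c + 1) * real (Suc l))"
    by simp
qed

definition hyp_series :: "real \<Rightarrow> real \<Rightarrow> real \<Rightarrow> real" where
  "hyp_series a c y = (\<Sum>j. hyp_coeff a c j * y ^ j)"

lemma hyp_series_0 [simp]: "hyp_series a c 0 = 1"
  using powser_zero[of "hyp_coeff a c"] by (simp add: hyp_series_def hyp_coeff_def)

lemma DERIV_hyp_series:
  assumes "c > 0" "a > - 1"
  shows "(hyp_series a c has_real_derivative (\<Sum>j. diffs (hyp_coeff a c) j * y ^ j)) (at y)"
  unfolding hyp_series_def[abs_def]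
  by (rule termdiffs_strong_converges_everywhere) (rule summable_hyp[OF assms])

text \<open>The operator y d/dy + a multiplies the j-th coefficient by a + j, so
  \<open>hyp_coeff_bessel\<close> applies; one more factor \<open>y\<close> aligns the exponents,
  and the missing zeroth Bessel term 1 produces 1 - \<phi>. In terms of P = y
  \<open>hyp_series a c y\<close> the left side is y P' - (1 - a) P.\<close>

lemma hyp_series_ode:
  assumes "c > 0" "a > - 1"
  shows "y * (y * (\<Sum>j. diffs (hyp_coeff a c) j * y ^ j) + a * hyp_series a c y)
    = a * c * (1 - bessel_series c y)"
proof -
  have s: "(\<lambda>j. real j * hyp_coeff a c j * y ^ (j - Suc 0)) sums (\<Sum>j. diffs (hyp_coeff a c) j * y ^ j)"
    using diffs_equiv[OF termdiff_converges_all[OF summable_hyp[OF assms]]] by simp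
  \<comment> \<open>At \<open>j = 0\<close> the truncated exponent \<open>j - Suc 0\<close> does no
    harm, because the factor \<open>real j\<close> vanishes.\<close>
  have e: "y * (real j * hyp_coeff a c j * y ^ (j - Suc 0)) = real j * hyp_coeff a c j * y ^ j" for j
    by (cases j) auto
  have "(\<lambda>j. real j * hyp_coeff a c j * y ^ j) sums (y * (\<Sum>j. diffs (hyp_coeff a c) j * y ^ j))"
    using sums_mult[OF s, of y] by (simp only: e)
  moreover have "(\<lambda>j. a * (hyp_coeff a c j * y ^ j)) sums (a * hyp_series a c y)"
    unfolding hyp_series_def by (intro sums_mult summable_sums summable_hyp assms)
  ultimately have "(\<lambda>j. (a + real j) * hyp_coeff a c j * y ^ j) sums
      (y * (\<Sum>j. diffs (hyp_coeff a c) j * y ^ j) + a * hyp_series a c y)"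
    by (auto dest: sums_add simp: algebra_simps)
  from sums_mult[OF this, of y]
  have "(\<lambda>j. - a * c * (bessel_coeff c (Suc j) * y ^ Suc j)) sums
      (y * (y * (\<Sum>j. diffs (hyp_coeff a c) j * y ^ j) + a * hyp_series a c y))"
    unfolding hyp_coeff_bessel[OF assms] by (simp add: mult_ac)
  moreover have "(\<lambda>j. - a * c * (bessel_coeff c (Suc j) * y ^ Suc j)) sums (- a * c * (bessel_series c y - 1))"
  proof -
    have "(\<lambda>j. bessel_coeff c j * y ^ j) sums bessel_series c y"
      unfolding bessel_series_def by (intro summable_sums summable_bessel assms)
    then have "(\<lambda>j. bessel_coeff c (Suc j) * y ^ Suc j) sums (bessel_series c y - 1)"
      by (subst sums_Suc_iff) (simp add: bessel_coeff_def)
    then show ?thesis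
      by (rule sums_mult)
  qed
  ultimately have "y * (y * (\<Sum>j. diffs (hyp_coeff a c) j * y ^ j) + a * hyp_series a c y)
      = - a * c * (bessel_series c y - 1)"
    by (rule sums_unique2)
  then show ?thesis
    by (simp add: algebra_simps)
qed

section \<open>Termwise differentiation of unordered sums\<close>

text \<open>The Weierstrass test makes the sums of \<open>f\<close> and of \<open>f'\<close>
  converge uniformly along the net of finite subsets of \<open>A\<close>. The theorem on derivatives
  of uniform limits concerns sequences, so a sequence of finite subsets that works for both sums is
  extracted first.\<close>

lemma has_vector_derivative_infsum:
  fixes f :: "'i \<Rightarrow> real \<Rightarrow> 'b::banach"
  assumes "convex S"
    and der: "\<And>k t. k \<in> A \<Longrightarrow> t \<in> S \<Longrightarrow> (f k has_vector_derivative f' k t) (at t within S)"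
    and f: "\<And>k t. k \<in> A \<Longrightarrow> t \<in> S \<Longrightarrow> norm (f k t) \<le> M k"
    and f': "\<And>k t. k \<in> A \<Longrightarrow> t \<in> S \<Longrightarrow> norm (f' k t) \<le> M k"
    and M: "M summable_on A"
    and t: "t \<in> S"
  shows "((\<lambda>t. \<Sum>\<^sub>\<infinity>k\<in>A. f k t) has_vector_derivative (\<Sum>\<^sub>\<infinity>k\<in>A. f' k t)) (at t within S)"
proof -
  define F where "F t = (\<Sum>\<^sub>\<infinity>k\<in>A. f k t)" for t
  define F' where "F' t = (\<Sum>\<^sub>\<infinity>k\<in>A. f' k t)" for t
  have uf: "uniform_limit S (\<lambda>X t. \<Sum>k\<in>X. f k t) F (finite_subsets_at_top A)"
    unfolding F_def using f M by (rule Weierstrass_m_test_general)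
  have uf': "uniform_limit S (\<lambda>X t. \<Sum>k\<in>X. f' k t) F' (finite_subsets_at_top A)"
    unfolding F'_def using f' M by (rule Weierstrass_m_test_general)
  \<comment> \<open>One finite set serves both sums at accuracy 1/(n+1), since both estimates hold
    eventually along the same proper filter.\<close>
  have "\<exists>X. finite X \<and> X \<subseteq> A \<and> (\<forall>t\<in>S. dist (\<Sum>k\<in>X. f k t) (F t) < inverse (real (Suc n))) \<and>
      (\<forall>t\<in>S. dist (\<Sum>k\<in>X. f' k t) (F' t) < inverse (real (Suc n)))" for n
  proof -
    have "\<forall>\<^sub>F X in finite_subsets_at_top A. finite X \<and> X \<subseteq> A"
      by (simp add: eventually_finite_subsets_at_top_weakI)
    moreover have "\<forall>\<^sub>F X in finite_subsets_at_top A. \<forall>t\<in>S. dist (\<Sum>k\<in>X. f k t) (F t) < inverse (real (Suc n))"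
      "\<forall>\<^sub>F X in finite_subsets_at_top A. \<forall>t\<in>S. dist (\<Sum>k\<in>X. f' k t) (F' t) < inverse (real (Suc n))"
      by (rule uniform_limitD[OF uf] uniform_limitD[OF uf'], simp)+
    ultimately have "\<forall>\<^sub>F X in finite_subsets_at_top A. finite X \<and> X \<subseteq> A \<and>
      (\<forall>t\<in>S. dist (\<Sum>k\<in>X. f k t) (F t) < inverse (real (Suc n))) \<and>
      (\<forall>t\<in>S. dist (\<Sum>k\<in>X. f' k t) (F' t) < inverse (real (Suc n)))"
      by eventually_elim auto
    then show ?thesis
      by (rule eventually_happens'[OF finite_subsets_at_top_neq_bot])
  qed
  then obtain X where X: "\<And>n. finite (X n)" "\<And>n. X n \<subseteq> A"
    "\<And>n t. t \<in> S \<Longrightarrow> dist (\<Sum>k\<in>X n. f k t) (F t) < inverse (real (Suc n))"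
    "\<And>n t. t \<in> S \<Longrightarrow> dist (\<Sum>k\<in>X n. f' k t) (F' t) < inverse (real (Suc n))"
    by metis
  have lim: "(\<lambda>n. \<Sum>k\<in>X n. f k s) \<longlonglongrightarrow> F s" if "s \<in> S" for s
  proof (rule metric_LIMSEQ_I)
    fix e :: real assume "e > 0"
    then obtain N where N: "inverse (real (Suc N)) < e"
      using reals_Archimedean by blast
    have "dist (\<Sum>k\<in>X n. f k s) (F s) < e" if "n \<ge> N" for n
    proof -
      have "inverse (real (Suc n)) \<le> inverse (real (Suc N))"
        using that by (intro le_imp_inverse_le) auto
      with X(3)[OF \<open>s \<in> S\<close>, of n] N show ?thesis
        by linarith
    qed
    then show "\<exists>N. \<forall>n\<ge>N. dist (\<Sum>k\<in>X n. f k s) (F s) < e"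
      by blast
  qed
  have "\<exists>g. \<forall>s\<in>S. (\<lambda>n. \<Sum>k\<in>X n. f k s) \<longlonglongrightarrow> g s \<and> (g has_derivative (\<lambda>h. h *\<^sub>R F' s)) (at s within S)"
  proof (rule has_derivative_sequence[where f = "\<lambda>n s. \<Sum>k\<in>X n. f k s"
        and f' = "\<lambda>n s h. \<Sum>k\<in>X n. h *\<^sub>R f' k s", OF \<open>convex S\<close> _ _ t lim[OF t]])
    show "((\<lambda>s. \<Sum>k\<in>X n. f k s) has_derivative (\<lambda>h. \<Sum>k\<in>X n. h *\<^sub>R f' k s)) (at s within S)"
      if "s \<in> S" for n s
      using der that X(2)[of n] unfolding has_vector_derivative_def
      by (intro has_derivative_sum) auto
    fix e :: real assume "e > 0"
    then obtain N where N: "inverse (real (Suc N)) < e"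
      using reals_Archimedean by blast
    have "norm ((\<Sum>k\<in>X n. h *\<^sub>R f' k s) - h *\<^sub>R F' s) \<le> e * norm h" if "n \<ge> N" "s \<in> S" for n s h
    proof -
      have "inverse (real (Suc n)) \<le> inverse (real (Suc N))"
        using that by (intro le_imp_inverse_le) auto
      with X(4)[OF \<open>s \<in> S\<close>, of n] N have "norm ((\<Sum>k\<in>X n. f' k s) - F' s) \<le> e"
        unfolding dist_norm by linarith
      then have "norm (h *\<^sub>R ((\<Sum>k\<in>X n. f' k s) - F' s)) \<le> e * norm h"
        by (simp add: mult.commute[of e] mult_left_mono)
      then show ?thesis
        by (simp add: scaleR_diff_right scaleR_sum_right)
    qed
    then show "\<forall>\<^sub>F n in sequentially. \<forall>s\<in>S. \<forall>h. norm ((\<Sum>k\<in>X n. h *\<^sub>R f' k s) - h *\<^sub>R F' s) \<le> e * norm h"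
      unfolding eventually_sequentially by blast
  qed
  then obtain g where g: "\<And>s. s \<in> S \<Longrightarrow> (\<lambda>n. \<Sum>k\<in>X n. f k s) \<longlonglongrightarrow> g s"
    "(g has_derivative (\<lambda>h. h *\<^sub>R F' t)) (at t within S)"
    using t by blast
  \<comment> \<open>The sequence theorem supplies only some limit function; uniqueness of limits
    identifies it with \<open>F\<close> on \<open>S\<close>.\<close>
  have "g s = F s" if "s \<in> S" for s
    using g(1)[OF that] lim[OF that] by (rule LIMSEQ_unique)
  then have "(F has_derivative (\<lambda>h. h *\<^sub>R F' t)) (at t within S)"
    using g(2) t by (intro has_derivative_transform[OF t _ g(2)]) auto
  then show ?thesis
    unfolding has_vector_derivative_def F_def F'_def .
qed

section \<open>Lattice sums and Sobolev weights\<close>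

lemma norm_real_vec_sq: "(norm (real_vec k))\<^sup>2 = (\<Sum>i\<in>UNIV. (real_of_int (k $ i))\<^sup>2)"
  by (simp add: norm_vec_def L2_set_def real_vec_def sum_nonneg)

lemma summable_on_int_inverse_square: "(\<lambda>j::int. 1 / (1 + (real_of_int j)\<^sup>2)) summable_on UNIV"
proof -
  have 1: "(\<lambda>m. 1 / (1 + (real m)\<^sup>2)) summable_on UNIV"
  proof (subst summable_on_UNIV_nonneg_real_iff)
    have "summable (\<lambda>m. 1 / (real (Suc m))\<^sup>2)"
      using inverse_squares_sums by (simp add: sums_iff)
    then have "summable (\<lambda>m. 1 / (1 + (real (Suc m))\<^sup>2))"
      by (rule summable_comparison_test[rotated]) (auto intro!: exI[of _ 0] frac_le)
    then show "summable (\<lambda>m. 1 / (1 + (real m)\<^sup>2))"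
      by (subst (asm) summable_Suc_iff)
  qed simp
  have "(\<lambda>j::int. 1 / (1 + (real_of_int j)\<^sup>2)) summable_on (range int)"
    by (subst summable_on_reindex) (use 1 in \<open>auto simp: o_def\<close>)
  moreover have "(\<lambda>j::int. 1 / (1 + (real_of_int j)\<^sup>2)) summable_on (range (\<lambda>m. - int m))"
    by (subst summable_on_reindex) (use 1 in \<open>auto simp: o_def inj_on_def\<close>)
  ultimately have "(\<lambda>j::int. 1 / (1 + (real_of_int j)\<^sup>2)) summable_on (range int \<union> range (\<lambda>m. - int m))"
    by (rule summable_on_union)
  moreover have "range int \<union> range (\<lambda>m. - int m) = UNIV"
  proof -
    have "j \<in> range int \<union> range (\<lambda>m. - int m)" for j
      by (cases j rule: int_cases2) auto
    then show ?thesis by blast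
  qed
  ultimately show ?thesis
    by simp
qed

text \<open>The n-th power of 1 / (1 + |k|^2) is a product of n equal factors, and the i-th of them
  is at most 1 / (1 + k_i^2). The product weight is summable because its finite sums are bounded by
  the n-th power of the one-dimensional sum.\<close>

lemma summable_on_lattice_weight:
  "(\<lambda>k::int^'n::finite. (1 + (norm (real_vec k))\<^sup>2) powr (- real CARD('n))) summable_on UNIV"
proof -
  define w where "w j = 1 / (1 + (real_of_int j)\<^sup>2)" for j
  have w0: "w j \<ge> 0" for j
    by (simp add: w_def)
  define W where "W = infsum w UNIV"
  have wW: "sum w B \<le> W" if "finite B" for B
    unfolding W_def using that summable_on_int_inverse_square w0
    by (intro finite_sum_le_infsum) (auto simp: w_def[abs_def])
  have "W \<ge> 0"
    using wW[of "{}"] by simp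
  have "(\<lambda>k::int^'n. \<Prod>i\<in>UNIV. w (k $ i)) summable_on UNIV"
  proof (rule nonneg_bdd_above_summable_on)
    show "bdd_above (sum (\<lambda>k::int^'n. \<Prod>i\<in>UNIV. w (k $ i)) ` {F. F \<subseteq> UNIV \<and> finite F})"
    proof (rule bdd_aboveI2)
      fix F :: "(int^'n) set" assume "F \<in> {F. F \<subseteq> UNIV \<and> finite F}"
      then have fin: "finite F"
        by simp
      \<comment> \<open>\<open>B i\<close> is the projection of \<open>F\<close> to the i-th
        coordinate. Thus \<open>F\<close> lies in the box with sides \<open>B i\<close>, over which
        the sum of the product weight factorises.\<close>
      define B where "B i = (\<lambda>k. k $ i) ` F" for i
      have "(\<Sum>k\<in>F. \<Prod>i\<in>UNIV. w (k $ i)) = (\<Sum>g\<in>vec_nth ` F. \<Prod>i\<in>UNIV. w (g i))"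
        by (subst sum.reindex) (auto simp: inj_on_def vec_eq_iff)
      also have "\<dots> \<le> (\<Sum>g\<in>PiE UNIV B. \<Prod>i\<in>UNIV. w (g i))"
        using fin w0 by (intro sum_mono2 finite_PiE) (auto simp: B_def intro: prod_nonneg)
      also have "\<dots> = (\<Prod>i\<in>UNIV. \<Sum>j\<in>B i. w j)"
        using fin by (subst prod_sum_PiE) (auto simp: B_def)
      also have "\<dots> \<le> (\<Prod>i\<in>(UNIV::'n set). W)"
        using fin w0 by (intro prod_mono) (auto simp: B_def intro: wW sum_nonneg)
      finally show "(\<Sum>k\<in>F. \<Prod>i\<in>UNIV. w (k $ i)) \<le> (\<Prod>i\<in>(UNIV::'n set). W)" .
    qed
  qed (use w0 in \<open>auto intro: prod_nonneg\<close>)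
  then show ?thesis
  proof (rule summable_on_comparison_test)
    fix k :: "int^'n"
    define N where "N = 1 + (norm (real_vec k))\<^sup>2"
    have N: "N > 0"
      by (simp add: N_def add_pos_nonneg)
    have "N powr (- real CARD('n)) = (\<Prod>i\<in>(UNIV::'n set). 1 / N)"
      using N by (simp add: powr_minus powr_realpow inverse_eq_divide power_one_over)
    also have "\<dots> \<le> (\<Prod>i\<in>UNIV. w (k $ i))"
    proof (intro prod_mono conjI)
      fix i :: 'n
      have "(real_of_int (k $ i))\<^sup>2 \<le> (norm (real_vec k))\<^sup>2"
        unfolding norm_real_vec_sq by (rule member_le_sum) auto
      then show "1 / N \<le> w (k $ i)"
        unfolding w_def N_def by (intro frac_le) (auto simp: add_pos_nonneg)
    qed (use N in auto)
    finally show "(1 + (norm (real_vec k))\<^sup>2) powr (- real CARD('n)) \<le> (\<Prod>i\<in>UNIV. w (k $ i))"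
      by (simp add: N_def)
  qed simp
qed

text \<open>Cauchy-Schwarz in pointwise form: q \<le> s/2 - n/2 and N = 1 + |k|^2 \<ge> 1 split the
  term into x N^(s/2) times N^(-n/2), and a product is at most the sum of the squares. The first
  square is summable by the Sobolev condition, the second by
  \<open>summable_on_lattice_weight\<close>.\<close>

lemma sobolev_weighted_l1:
  fixes u :: "((real ^ 'n::finite \<Rightarrow> complex) \<Rightarrow> complex)"
  assumes u: "u \<in> sobolev_torus s" and s: "s \<ge> real CARD('n) + 2 * q"
  shows "(\<lambda>k. norm (fourier_coeff u k) * (1 + (norm (real_vec k))\<^sup>2) powr q) summable_on UNIV"
proof (rule summable_on_comparison_test)
  show "(\<lambda>k. (1 + (norm (real_vec k))\<^sup>2) powr s * (norm (fourier_coeff u k))\<^sup>2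
      + (1 + (norm (real_vec k))\<^sup>2) powr (- real CARD('n))) summable_on UNIV"
    using u by (intro summable_on_add summable_on_lattice_weight) (auto simp: sobolev_torus_def)
  fix k :: "int ^ 'n"
  define N where "N = 1 + (norm (real_vec k))\<^sup>2"
  define x where "x = norm (fourier_coeff u k)"
  have N: "N \<ge> 1"
    by (simp add: N_def)
  define z where "z = x * N powr (s / 2)"
  have "x * N powr q \<le> x * (N powr (s / 2) * N powr (- real CARD('n) / 2))"
    using N s by (intro mult_left_mono) (auto simp: x_def simp flip: powr_add intro!: powr_mono)
  also have "\<dots> = z * N powr (- real CARD('n) / 2)"
    by (simp add: z_def)
  also have "\<dots> \<le> z\<^sup>2 + (N powr (- real CARD('n) / 2))\<^sup>2"
  proof -
    have "2 * (z * N powr (- real CARD('n) / 2)) \<le> z\<^sup>2 + (N powr (- real CARD('n) / 2))\<^sup>2"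
      using sum_squares_bound[of z "N powr (- real CARD('n) / 2)"] by simp
    moreover have "z * N powr (- real CARD('n) / 2) \<ge> 0"
      by (simp add: z_def x_def)
    ultimately show ?thesis
      by linarith
  qed
  also have "\<dots> = N powr s * x\<^sup>2 + N powr (- real CARD('n))"
  proof -
    have "(N powr r)\<^sup>2 = N powr (2 * r)" for r
      by (simp add: power2_eq_square flip: powr_add)
    from this[of "s / 2"] this[of "- real CARD('n) / 2"] show ?thesis
      by (simp add: z_def power_mult_distrib)
  qed
  finally show "x * N powr q \<le> N powr s * x\<^sup>2 + N powr (- real CARD('n))" .
qed auto

section \<open>Two-sided power growth of the multiplier and the frequencies\<close>

text \<open>With H the series, h = y^(-\<alpha>) y H satisfies h' = a c y^(-\<alpha>-1) (1 - \<phi>)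
  by \<open>hyp_series_ode\<close>. As \<phi> is bounded, the right side is integrable at infinity,
  which bounds h above; the argument for the lower bound depends on the sign of a = 1 -
  \<alpha>.\<close>

lemma hyp_series_growth:
  assumes c: "c \<ge> 1 / 2" and \<alpha>: "0 < \<alpha>" "\<alpha> < 2" and y1: "y1 > 0"
  obtains c0 C where "c0 > 0" "C > 0"
    "\<And>y. y \<ge> y1 \<Longrightarrow> c0 * y powr \<alpha> \<le> y * hyp_series (1 - \<alpha>) c y"
    "\<And>y. y \<ge> y1 \<Longrightarrow> y * hyp_series (1 - \<alpha>) c y \<le> C * y powr \<alpha>"
proof -
  define a where "a = 1 - \<alpha>"
  define H where "H = hyp_series a c"
  define h where "h y = y powr (- \<alpha>) * (y * H y)" for y
  have pos: "c > 0" "a > - 1"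
    using c \<alpha> by (auto simp: a_def)
  have h: "y * H y = h y * y powr \<alpha>" if "y > 0" for y
    using that by (simp add: h_def powr_minus)
  have dh: "(h has_real_derivative y powr (- \<alpha> - 1) * (a * c * (1 - bessel_series c y))) (at y)"
    if y: "y > 0" for y
  proof -
    define D where "D = (\<Sum>j. diffs (hyp_coeff a c) j * y ^ j)"
    have "((\<lambda>y. y powr (- \<alpha>) * (y * H y)) has_real_derivative
        (- \<alpha>) * y powr (- \<alpha> - 1) * (y * H y) + (1 * H y + D * y) * y powr (- \<alpha>)) (at y)"
      unfolding H_def D_def
      by (intro DERIV_mult DERIV_ident DERIV_hyp_series pos has_real_derivative_powr y)
    also have "y powr (- \<alpha>) = y powr (- \<alpha> - 1) * y"
      using powr_mult_base[of y "- \<alpha> - 1"] y by (simp add: mult.commute)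
    also have "(- \<alpha>) * y powr (- \<alpha> - 1) * (y * H y) + (1 * H y + D * y) * (y powr (- \<alpha> - 1) * y)
        = y powr (- \<alpha> - 1) * (y * (y * D + a * H y))"
      by (simp add: a_def algebra_simps)
    also have "y * (y * D + a * H y) = a * c * (1 - bessel_series c y)"
      unfolding D_def H_def by (rule hyp_series_ode[OF pos])
    finally show ?thesis
      unfolding h_def .
  qed
  have dp: "((\<lambda>x. x powr r) has_real_derivative r * y powr (r - 1)) (at y)" if "y > 0" for y r :: real
    using that by (rule has_real_derivative_powr)
  \<comment> \<open>\<open>K\<close> is chosen so that K y^(-\<alpha>) has derivative -2 |a| c
    y^(-\<alpha>-1). This offsets h' because |1 - \<phi>| \<le> 2.\<close>
  define K where "K = 2 * \<bar>a\<bar> * c / \<alpha>"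
  have K: "K \<ge> 0"
    using pos \<alpha> by (simp add: K_def)
  have upper: "h y \<le> h y1 + K * y1 powr (- \<alpha>)" if y: "y \<ge> y1" for y
  proof -
    have "h y + K * y powr (- \<alpha>) \<le> h y1 + K * y1 powr (- \<alpha>)"
    proof (rule DERIV_nonpos_imp_nonincreasing[OF y])
      fix x assume "y1 \<le> x"
      with y1 have x: "x > 0" by simp
      have "\<bar>a * c * (1 - bessel_series c x)\<bar> \<le> \<bar>a\<bar> * c * 2"
        using bessel_series_bound[OF c, of x] x pos unfolding abs_mult by (intro mult_mono) auto
      then have "a * c * (1 - bessel_series c x) - 2 * \<bar>a\<bar> * c \<le> 0"
        by linarith
      then have "x powr (- \<alpha> - 1) * (a * c * (1 - bessel_series c x) - 2 * \<bar>a\<bar> * c) \<le> 0"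
        by (intro mult_nonneg_nonpos) auto
      moreover have "((\<lambda>x. h x + K * x powr (- \<alpha>)) has_real_derivative
          x powr (- \<alpha> - 1) * (a * c * (1 - bessel_series c x)) + K * ((- \<alpha>) * x powr (- \<alpha> - 1))) (at x)"
        by (intro DERIV_add DERIV_cmult dh dp x)
      moreover have "x powr (- \<alpha> - 1) * (a * c * (1 - bessel_series c x)) + K * ((- \<alpha>) * x powr (- \<alpha> - 1))
          = x powr (- \<alpha> - 1) * (a * c * (1 - bessel_series c x) - 2 * \<bar>a\<bar> * c)"
        using \<alpha> by (simp add: K_def algebra_simps)
      ultimately show "\<exists>D. ((\<lambda>x. h x + K * x powr (- \<alpha>)) has_real_derivative D) (at x) \<and> D \<le> 0"
        by metis
    qed
    moreover have "K * y powr (- \<alpha>) \<ge> 0"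
      using K by simp
    ultimately show ?thesis
      by linarith
  qed
  have "\<exists>c0>0. \<forall>y\<ge>y1. c0 \<le> h y"
  proof -
    consider "a > 0" | "a = 0" | "a < 0"
      by linarith
    then show ?thesis
    proof cases
      case 1
      \<comment> \<open>Here \<phi> \<le> 1 makes \<open>h\<close> nondecreasing, so a positive
        value at some \<open>z < y1\<close> is a lower bound. Such a \<open>z\<close> exists near 0,
        where \<open>H\<close> tends to 1.\<close>
      have "H \<midarrow>0\<rightarrow> 1"
        using DERIV_isCont[OF DERIV_hyp_series[OF pos, of 0]] by (simp add: isCont_def H_def)
      then obtain d where d: "d > 0" "\<And>x. x \<noteq> 0 \<Longrightarrow> \<bar>x\<bar> < d \<Longrightarrow> \<bar>H x - 1\<bar> < 1"
        using LIM_D[of H 1 0 1] by auto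
      define z where "z = min d y1 / 2"
      have z: "z > 0" "z < d" "z < y1"
        using d(1) y1 by (auto simp: z_def)
      then have Hz: "H z > 0"
        using d(2)[of z] by auto
      have "h z \<le> h y" if "y \<ge> y1" for y
      proof (rule DERIV_nonneg_imp_nondecreasing[where f = h])
        show "z \<le> y"
          using z that by simp
        fix x assume "z \<le> x"
        with z have x: "x > 0" by simp
        have "x powr (- \<alpha> - 1) * (a * c * (1 - bessel_series c x)) \<ge> 0"
          using bessel_series_bound[OF c, of x] x pos 1 by (intro mult_nonneg_nonneg) auto
        with dh[OF x] show "\<exists>D. (h has_real_derivative D) (at x) \<and> D \<ge> 0"
          by blast
      qed
      moreover have "h z > 0"
        using z Hz by (simp add: h_def)
      ultimately show ?thesis
        by blast
    next
      case 2
      \<comment> \<open>This is the case \<alpha> = 1, in which (0)_j = 0 for j > 0 collapses the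
        series to 1.\<close>
      have "hyp_coeff a c j = (if j = 0 then 1 else 0)" for j
        using 2 by (simp add: hyp_coeff_def pochhammer_0_left)
      then have "H y = 1" for y
        using suminf_finite[of "{0}" "\<lambda>j. hyp_coeff a c j * y ^ j"]
        by (simp add: H_def hyp_series_def)
      moreover have "\<alpha> = 1"
        using 2 by (simp add: a_def)
      ultimately have "h y = 1" if "y \<ge> y1" for y
        using y1 that by (simp add: h_def powr_minus)
      then show ?thesis
        by (intro exI[of _ 1]) auto
    next
      case 3
      \<comment> \<open>Now \<open>h\<close> is nonincreasing. Subtracting y^a repairs this:
        \<open>k\<close> has derivative -a y^(-\<alpha>-1) (y - c (1 - \<phi>)), nonnegative by
        \<open>bessel_series_ge\<close>, and \<open>k\<close> stays below \<open>h\<close>.\<close>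
      define k where "k y = h y - y powr a" for y
      have k: "k y = y powr a * (H y - 1)" if "y > 0" for y
        using that by (simp add: k_def h_def a_def powr_diff powr_minus field_simps)
      \<comment> \<open>This number is H'(0) = -a / (2 (a + 1) (c + 1)). Hence \<open>H\<close>
        exceeds 1 just to the right of 0, and k = y^a (H - 1) is positive there.\<close>
      have "diffs (hyp_coeff a c) 0 > 0"
      proof -
        have "a / (a + 1) < 0"
          using 3 pos by (simp add: divide_neg_pos)
        then have "- (a / (a + 1)) / (2 * (c + 1)) > 0"
          using pos by (intro divide_pos_pos) auto
        then show ?thesis
          by (simp add: diffs_def hyp_coeff_def mult_ac)
      qed
      then have "(\<Sum>j. diffs (hyp_coeff a c) j * 0 ^ j) > 0"
        by (subst powser_zero)
      from DERIV_pos_inc_right[OF DERIV_hyp_series[OF pos] this]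
      obtain d where d: "d > 0" "\<And>x. 0 < x \<Longrightarrow> x < d \<Longrightarrow> 1 < H x"
        by (auto simp: H_def)
      define z where "z = min d y1 / 2"
      have z: "z > 0" "z < d" "z < y1"
        using d(1) y1 by (auto simp: z_def)
      have "k z \<le> h y" if "y \<ge> y1" for y
      proof -
        have "k z \<le> k y"
        proof (rule DERIV_nonneg_imp_nondecreasing[where f = k])
          show "z \<le> y"
            using z that by simp
          fix x assume "z \<le> x"
          with z have x: "x > 0" by simp
          have "c * (1 - bessel_series c x) \<le> x"
            using bessel_series_ge[OF c, of x] x pos by (simp add: field_simps)
          then have "0 \<le> x powr (- \<alpha> - 1) * (- a * (x - c * (1 - bessel_series c x)))"
            using 3 by (intro mult_nonneg_nonneg) auto
          moreover have "(k has_real_derivative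
              x powr (- \<alpha> - 1) * (a * c * (1 - bessel_series c x)) - a * x powr (a - 1)) (at x)"
            unfolding k_def[abs_def] by (intro DERIV_diff dh dp x)
          moreover have "x powr (a - 1) = x powr (- \<alpha> - 1) * x"
            using powr_mult_base[of x "- \<alpha> - 1"] x by (simp add: a_def mult.commute)
          ultimately show "\<exists>D. (k has_real_derivative D) (at x) \<and> D \<ge> 0"
            by (auto simp: algebra_simps)
        qed
        then show ?thesis
          by (smt (verit) k_def powr_ge_zero)
      qed
      moreover have "k z > 0"
        using z d(2)[of z] by (simp add: k)
      ultimately show ?thesis
        by blast
    qed
  qed
  then obtain c0 where c0: "c0 > 0" "\<And>y. y \<ge> y1 \<Longrightarrow> c0 \<le> h y"
    by blast
  show ?thesis
  proof (rule that[of c0 "h y1 + K * y1 powr (- \<alpha>)"])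
    show "h y1 + K * y1 powr (- \<alpha>) > 0"
      using c0(1) c0(2)[of y1] upper[of y1] by simp
    show "c0 * y powr \<alpha> \<le> y * hyp_series (1 - \<alpha>) c y" if "y \<ge> y1" for y
      using h[of y] c0(2)[OF that] y1 that by (simp add: mult_right_mono flip: a_def H_def)
    show "y * hyp_series (1 - \<alpha>) c y \<le> (h y1 + K * y1 powr (- \<alpha>)) * y powr \<alpha>" if "y \<ge> y1" for y
      using h[of y] upper[OF that] y1 that by (simp add: mult_right_mono flip: a_def H_def)
  qed (rule c0(1))
qed

lemma multiplier_hyp_series:
  fixes \<nu> :: "real ^ 'n::finite"
  assumes "\<delta> > 0"
  defines "y \<equiv> (norm \<nu>)\<^sup>2 * \<delta>\<^sup>2 / 4"
  shows "- multiplier \<delta> \<beta> \<nu> = 4 / \<delta>\<^sup>2 *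
    (y * hyp_series (1 - (\<beta> - real CARD('n)) / 2) (real CARD('n) / 2) y)"
proof -
  define n where "n = real CARD('n)"
  have p: "(n + 2 - \<beta>) / 2 = 1 - (\<beta> - n) / 2" "(n + 2) / 2 = n / 2 + 1"
    "(n + 4 - \<beta>) / 2 = 1 - (\<beta> - n) / 2 + 1" "- (1 / 4) * (norm \<nu>)\<^sup>2 * \<delta>\<^sup>2 = - y"
    by (simp_all add: y_def field_simps)
  have "- multiplier \<delta> \<beta> \<nu> = (norm \<nu>)\<^sup>2 * hyp_series (1 - (\<beta> - n) / 2) (n / 2) y"
    unfolding multiplier_def n_def[symmetric] p hypergeom_hyp_coeff hyp_series_def by simp
  also have "(norm \<nu>)\<^sup>2 = 4 / \<delta>\<^sup>2 * y"
    using assms by (simp add: y_def)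
  finally show ?thesis
    by (simp add: n_def)
qed

text \<open>Integrality keeps nonzero modes away from the origin, in the range where the growth
  bounds hold.\<close>

lemma norm_real_vec_ge_1:
  assumes "k \<noteq> (0 :: int ^ 'n::finite)"
  shows "(norm (real_vec k))\<^sup>2 \<ge> 1"
proof -
  obtain i where "k $ i \<noteq> 0"
    using assms by (auto simp: vec_eq_iff)
  then have "1 \<le> (k $ i)\<^sup>2"
    by (simp add: int_one_le_iff_zero_less)
  then have "1 \<le> (real_of_int (k $ i))\<^sup>2"
    by (metis of_int_1_le_iff of_int_power)
  also have "\<dots> \<le> (norm (real_vec k))\<^sup>2"
    unfolding norm_real_vec_sq by (rule member_le_sum) auto
  finally show ?thesis .
qed

text \<open>For k \<noteq> 0 the argument y = |k|^2 \<delta>^2 / 4 is at least \<delta>^2 / 4, so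
  \<open>hyp_series_growth\<close> applies with that threshold. The square root halves the exponent
  \<alpha>. The lower bound also shows that the multiplier is negative at k.\<close>

lemma frequency_growth:
  assumes "\<delta> > 0" "real CARD('n::finite) < \<beta>" "\<beta> < real CARD('n) + 4"
  obtains b B where "b > 0" "B > 0"
    "\<And>k :: int ^ 'n. k \<noteq> 0 \<Longrightarrow>
       b * (1 + (norm (real_vec k))\<^sup>2) powr ((\<beta> - real CARD('n)) / 4)
         \<le> sqrt (- multiplier \<delta> \<beta> (real_vec k))"
    "\<And>k :: int ^ 'n. k \<noteq> 0 \<Longrightarrow>
       sqrt (- multiplier \<delta> \<beta> (real_vec k))
         \<le> B * (1 + (norm (real_vec k))\<^sup>2) powr ((\<beta> - real CARD('n)) / 4)"
proof -
  define \<alpha> where "\<alpha> = (\<beta> - real CARD('n)) / 2"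
  have \<alpha>: "0 < \<alpha>" "\<alpha> < 2"
    using assms by (auto simp: \<alpha>_def)
  \<comment> \<open>n \<ge> 1 places c = n/2 in the range where the Bessel energy does not
    increase.\<close>
  have c: "real CARD('n) / 2 \<ge> 1 / 2"
    using zero_less_card_finite[where 'a = 'n] by linarith
  define y1 where "y1 = \<delta>\<^sup>2 / 4"
  have y1: "y1 > 0"
    using assms by (simp add: y1_def)
  obtain c0 C where C: "c0 > 0" "C > 0"
    "\<And>y. y \<ge> y1 \<Longrightarrow> c0 * y powr \<alpha> \<le> y * hyp_series (1 - \<alpha>) (real CARD('n) / 2) y"
    "\<And>y. y \<ge> y1 \<Longrightarrow> y * hyp_series (1 - \<alpha>) (real CARD('n) / 2) y \<le> C * y powr \<alpha>"
    using hyp_series_growth[OF c \<alpha> y1] by metis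
  \<comment> \<open>The factor 1/2 comes from 1 + r \<le> 2 r for r = |k|^2 \<ge> 1, and division by
    \<open>y1\<close> is the prefactor 4 / \<delta>^2 of the multiplier.\<close>
  define b where "b = c0 * (y1 / 2) powr \<alpha> / y1"
  define B where "B = C * y1 powr \<alpha> / y1"
  have bB: "b > 0" "B > 0"
    using C y1 by (auto simp: b_def B_def)
  have bounds: "b * (1 + (norm (real_vec k))\<^sup>2) powr \<alpha> \<le> - multiplier \<delta> \<beta> (real_vec k) \<and>
      - multiplier \<delta> \<beta> (real_vec k) \<le> B * (1 + (norm (real_vec k))\<^sup>2) powr \<alpha>"
    if k: "k \<noteq> 0" for k :: "int ^ 'n"
  proof -
    define r where "r = (norm (real_vec k))\<^sup>2"
    have r: "r \<ge> 1"
      unfolding r_def using k by (rule norm_real_vec_ge_1)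
    have y: "r * y1 \<ge> y1"
      using r y1 by simp
    have m: "- multiplier \<delta> \<beta> (real_vec k)
        = r * y1 * hyp_series (1 - \<alpha>) (real CARD('n) / 2) (r * y1) / y1"
    proof -
      have "(norm (real_vec k))\<^sup>2 * \<delta>\<^sup>2 / 4 = r * y1" "4 / \<delta>\<^sup>2 * z = z / y1" for z
        by (simp_all add: r_def y1_def)
      then show ?thesis
        using multiplier_hyp_series[OF assms(1), of \<beta> "real_vec k"] by (simp only: \<alpha>_def)
    qed
    have "b * (1 + r) powr \<alpha> = c0 * ((1 + r) * (y1 / 2)) powr \<alpha> / y1"
      by (simp only: b_def powr_mult) simp
    also have "\<dots> \<le> c0 * (r * y1) powr \<alpha> / y1"
      using r y1 C \<alpha> by (intro divide_right_mono mult_left_mono powr_mono2) (auto simp: field_simps)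
    also have "\<dots> \<le> - multiplier \<delta> \<beta> (real_vec k)"
      unfolding m using C(3)[OF y] y1 by (intro divide_right_mono) auto
    finally have 1: "b * (1 + r) powr \<alpha> \<le> - multiplier \<delta> \<beta> (real_vec k)" .
    have "- multiplier \<delta> \<beta> (real_vec k) \<le> C * (r * y1) powr \<alpha> / y1"
      unfolding m using C(4)[OF y] y1 by (intro divide_right_mono) auto
    also have "\<dots> \<le> C * ((1 + r) * y1) powr \<alpha> / y1"
      using r y1 C \<alpha> by (intro divide_right_mono mult_left_mono powr_mono2) (auto simp: field_simps)
    also have "\<dots> = B * (1 + r) powr \<alpha>"
      by (simp only: B_def powr_mult) simp
    finally show ?thesis
      using 1 by (simp add: r_def)
  qed
  have s: "sqrt (e * x powr \<alpha>) = sqrt e * x powr (\<alpha> / 2)" for e x :: real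
    using powr_half_sqrt[of "x powr \<alpha>"] by (simp add: real_sqrt_mult powr_powr)
  show ?thesis
  proof (rule that[of "sqrt b" "sqrt B"])
    fix k :: "int ^ 'n" assume "k \<noteq> 0"
    from bounds[OF this, THEN conjunct1, THEN real_sqrt_le_mono]
      bounds[OF this, THEN conjunct2, THEN real_sqrt_le_mono]
    show "sqrt b * (1 + (norm (real_vec k))\<^sup>2) powr ((\<beta> - real CARD('n)) / 4)
         \<le> sqrt (- multiplier \<delta> \<beta> (real_vec k))"
      "sqrt (- multiplier \<delta> \<beta> (real_vec k))
         \<le> sqrt B * (1 + (norm (real_vec k))\<^sup>2) powr ((\<beta> - real CARD('n)) / 4)"
      unfolding s unfolding \<alpha>_def by simp_all
  qed (use bB in auto)
qed

section \<open>Termwise time derivatives and their common majorant\<close>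

text \<open>Each differentiation of the cosine advances its phase by a quarter period, so one family
  contains all derivatives of cosine and sine.\<close>

definition trig_deriv :: "nat \<Rightarrow> real \<Rightarrow> real" where
  "trig_deriv j t = cos (t + real j * (pi / 2))"

text \<open>The index shift by 3 turns the cosine into a sine.\<close>

definition wave_term_deriv ::
    "nat \<Rightarrow> real \<Rightarrow> real \<Rightarrow> ((real ^ 'n::finite \<Rightarrow> complex) \<Rightarrow> complex) \<Rightarrow>
     ((real ^ 'n \<Rightarrow> complex) \<Rightarrow> complex) \<Rightarrow> real ^ 'n \<Rightarrow> int ^ 'n \<Rightarrow> real \<Rightarrow> complex" where
  "wave_term_deriv j \<delta> \<beta> f g x k t =
     (let \<omega> = sqrt (- multiplier \<delta> \<beta> (real_vec k)) in
       (fourier_coeff f k * complex_of_real (\<omega> ^ j * trig_deriv j (\<omega> * t)) +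
        fourier_coeff g k / complex_of_real \<omega> * complex_of_real (\<omega> ^ j * trig_deriv (j + 3) (\<omega> * t))) *
       fourier_mode k x)"

lemma trig_deriv_3: "trig_deriv 3 t = sin t"
proof -
  have "real 3 * (pi / 2) = 3 / 2 * pi"
    by simp
  then show ?thesis
    by (simp only: trig_deriv_def cos_add cos_3over2_pi sin_3over2_pi)
qed

lemma wave_term_deriv_0: "wave_term_deriv 0 \<delta> \<beta> f g x k t = wave_term \<delta> \<beta> f g x t k"
  by (simp add: wave_term_deriv_def wave_term_def trig_deriv_3) (simp add: trig_deriv_def)

lemma DERIV_trig_deriv:
  "((\<lambda>t. \<omega> ^ j * trig_deriv i (\<omega> * t)) has_real_derivative \<omega> ^ Suc j * trig_deriv (Suc i) (\<omega> * t)) (at t)"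
proof -
  have "\<omega> * t + real (Suc i) * (pi / 2) = \<omega> * t + real i * (pi / 2) + pi / 2"
    by (simp add: algebra_simps)
  then have "trig_deriv (Suc i) (\<omega> * t) = - sin (\<omega> * t + real i * (pi / 2))"
    unfolding trig_deriv_def by (simp only: cos_add[of _ "pi / 2"]) simp
  then show ?thesis
    unfolding trig_deriv_def[of i] by (auto intro!: derivative_eq_intros)
qed

lemma wave_term_deriv_vector_derivative:
  "(wave_term_deriv j \<delta> \<beta> f g x k has_vector_derivative wave_term_deriv (Suc j) \<delta> \<beta> f g x k t)
     (at t within S)"
proof -
  define \<omega> where "\<omega> = sqrt (- multiplier \<delta> \<beta> (real_vec k))"
  have d: "((\<lambda>t. complex_of_real (\<omega> ^ j * trig_deriv i (\<omega> * t))) has_vector_derivative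
      complex_of_real (\<omega> ^ Suc j * trig_deriv (Suc i) (\<omega> * t))) (at t within S)" for i
    by (rule has_vector_derivative_of_real[OF has_field_derivative_at_within[OF DERIV_trig_deriv]])
  show ?thesis
    unfolding wave_term_deriv_def Let_def \<omega>_def[symmetric]
    unfolding add_Suc
    by (intro has_vector_derivative_mult_left has_vector_derivative_add has_vector_derivative_mult_right d)
qed

text \<open>A single bound has to serve all orders up to \<open>p\<close>, hence |\<omega>|^j is
  replaced by (1 + |\<omega>|)^p. The absolute values keep the bound valid whatever the sign under
  the root, and for \<omega> = 0 the convention x / 0 = 0 removes the \<open>g\<close> term on both
  sides.\<close>

lemma norm_wave_term_deriv_le:
  fixes \<delta> \<beta> :: real and k :: "int ^ 'n::finite"
  assumes "j \<le> p"
  defines "\<omega> \<equiv> sqrt (- multiplier \<delta> \<beta> (real_vec k))"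
  shows "norm (wave_term_deriv j \<delta> \<beta> f g x k t) \<le>
    norm (fourier_coeff f k) * (1 + \<bar>\<omega>\<bar>) ^ p + norm (fourier_coeff g k) * ((1 + \<bar>\<omega>\<bar>) ^ p / \<bar>\<omega>\<bar>)"
proof -
  have t: "\<bar>\<omega> ^ j * trig_deriv i s\<bar> \<le> (1 + \<bar>\<omega>\<bar>) ^ p" for i s
  proof -
    have "\<bar>\<omega> ^ j * trig_deriv i s\<bar> = \<bar>\<omega>\<bar> ^ j * \<bar>trig_deriv i s\<bar>"
      by (simp add: abs_mult power_abs)
    also have "\<dots> \<le> (1 + \<bar>\<omega>\<bar>) ^ j * 1"
      unfolding trig_deriv_def by (intro mult_mono power_mono) auto
    also have "\<dots> \<le> (1 + \<bar>\<omega>\<bar>) ^ p"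
      using assms by (simp add: power_increasing)
    finally show ?thesis .
  qed
  have "norm (fourier_mode k x) = 1"
    by (simp add: fourier_mode_def)
  then have "norm (wave_term_deriv j \<delta> \<beta> f g x k t) \<le>
      norm (fourier_coeff f k * complex_of_real (\<omega> ^ j * trig_deriv j (\<omega> * t))) +
      norm (fourier_coeff g k / complex_of_real (\<omega>) * complex_of_real (\<omega> ^ j * trig_deriv (j + 3) (\<omega> * t)))"
    unfolding wave_term_deriv_def Let_def \<omega>_def[symmetric] norm_mult[of _ "fourier_mode k x"]
    by (metis mult.right_neutral norm_triangle_ineq)
  also have "\<dots> = norm (fourier_coeff f k) * \<bar>\<omega> ^ j * trig_deriv j (\<omega> * t)\<bar> +
      norm (fourier_coeff g k) / \<bar>\<omega>\<bar> * \<bar>\<omega> ^ j * trig_deriv (j + 3) (\<omega> * t)\<bar>"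
    unfolding norm_mult norm_divide norm_of_real by simp
  also have "\<dots> \<le> norm (fourier_coeff f k) * (1 + \<bar>\<omega>\<bar>) ^ p +
      norm (fourier_coeff g k) / \<bar>\<omega>\<bar> * (1 + \<bar>\<omega>\<bar>) ^ p"
    by (intro add_mono mult_left_mono t) auto
  finally show ?thesis
    by simp
qed

text \<open>With N = 1 + |k|^2 and q = (\<beta> - n)/4, frequencies of order N^q turn the two terms
  into multiples of the coefficients weighted by N^(p q) and N^((p-1) q).
  \<open>sobolev_weighted_l1\<close> sums these exactly under the conditions on \<open>s1\<close>
  and \<open>s2\<close>; for p = 0 the second exponent is negative.\<close>

lemma wave_majorant_summable:
  fixes f g :: "(real ^ 'n::finite \<Rightarrow> complex) \<Rightarrow> complex" and \<delta> \<beta> :: real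
  assumes "\<delta> > 0" "real CARD('n) < \<beta>" "\<beta> < real CARD('n) + 4"
    and "f \<in> sobolev_torus s1" "g \<in> sobolev_torus s2"
    and s1: "s1 \<ge> real CARD('n) + real p * ((\<beta> - real CARD('n)) / 2)"
    and s2: "s2 \<ge> real CARD('n) + (real p - 1) * ((\<beta> - real CARD('n)) / 2)"
  defines "\<omega> k \<equiv> sqrt (- multiplier \<delta> \<beta> (real_vec k))"
  shows "(\<lambda>k. norm (fourier_coeff f k) * (1 + \<bar>\<omega> k\<bar>) ^ p
      + norm (fourier_coeff g k) * ((1 + \<bar>\<omega> k\<bar>) ^ p / \<bar>\<omega> k\<bar>)) summable_on - {0}"
proof -
  define q where "q = (\<beta> - real CARD('n)) / 4"
  have q: "q > 0"
    using assms by (simp add: q_def)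
  define N where "N k = 1 + (norm (real_vec k))\<^sup>2" for k :: "int ^ 'n"
  have N: "N k \<ge> 1" for k
    by (simp add: N_def)
  obtain b B where bB: "b > 0" "B > 0"
    "\<And>k. k \<noteq> 0 \<Longrightarrow> b * N k powr q \<le> \<omega> k" "\<And>k. k \<noteq> 0 \<Longrightarrow> \<omega> k \<le> B * N k powr q"
    using frequency_growth[OF assms(1-3)] unfolding N_def q_def \<omega>_def by metis
  have sum: "(\<lambda>k. norm (fourier_coeff f k) * N k powr (real p * q)) summable_on UNIV"
    "(\<lambda>k. norm (fourier_coeff g k) * N k powr ((real p - 1) * q)) summable_on UNIV"
  proof -
    have q2: "2 * (r * q) = r * ((\<beta> - real CARD('n)) / 2)" for r
      by (simp add: q_def)
    have "s1 \<ge> real CARD('n) + 2 * (real p * q)" "s2 \<ge> real CARD('n) + 2 * ((real p - 1) * q)"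
      using s1 s2 by (simp_all only: q2)
    then show "(\<lambda>k. norm (fourier_coeff f k) * N k powr (real p * q)) summable_on UNIV"
      "(\<lambda>k. norm (fourier_coeff g k) * N k powr ((real p - 1) * q)) summable_on UNIV"
      unfolding N_def using assms(4,5) by (blast intro: sobolev_weighted_l1)+
  qed
  have "(\<lambda>k. (1 + B) ^ p * (norm (fourier_coeff f k) * N k powr (real p * q))
      + (1 + B) ^ p / b * (norm (fourier_coeff g k) * N k powr ((real p - 1) * q))) summable_on - {0}"
    by (intro summable_on_add summable_on_cmult_right) (auto intro: summable_on_subset sum)
  then show ?thesis
  proof (rule summable_on_comparison_test)
    fix k :: "int ^ 'n" assume "k \<in> - {0}"
    then have k: "k \<noteq> 0" by simp
    have b: "b * N k powr q > 0"
      using bB N[of k] by simp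
    then have \<omega>: "\<omega> k > 0"
      using bB(3)[OF k] by linarith
    \<comment> \<open>Since N^q \<ge> 1, the summand 1 is absorbed into the growth bound.\<close>
    have "1 + \<bar>\<omega> k\<bar> \<le> N k powr q + B * N k powr q"
      using bB(4)[OF k] \<omega> ge_one_powr_ge_zero[OF N[of k], of q] q by linarith
    then have "(1 + \<bar>\<omega> k\<bar>) ^ p \<le> ((1 + B) * N k powr q) ^ p"
      by (intro power_mono) (auto simp: algebra_simps)
    also have "\<dots> = (1 + B) ^ p * N k powr (real p * q)"
      using N[of k] by (simp add: power_mult_distrib powr_power mult.commute)
    finally have 1: "(1 + \<bar>\<omega> k\<bar>) ^ p \<le> (1 + B) ^ p * N k powr (real p * q)" .
    \<comment> \<open>The lower bound on \<omega> gains the factor N^(-q), which is why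
      \<open>g\<close> may have one step less regularity than \<open>f\<close>.\<close>
    then have "(1 + \<bar>\<omega> k\<bar>) ^ p / \<bar>\<omega> k\<bar> \<le> (1 + B) ^ p * N k powr (real p * q) / (b * N k powr q)"
      using bB(3)[OF k] b \<omega> bB by (intro frac_le) auto
    also have "\<dots> = (1 + B) ^ p / b * N k powr ((real p - 1) * q)"
      by (simp add: left_diff_distrib powr_diff)
    finally have 2: "(1 + \<bar>\<omega> k\<bar>) ^ p / \<bar>\<omega> k\<bar> \<le> (1 + B) ^ p / b * N k powr ((real p - 1) * q)" .
    show "norm (fourier_coeff f k) * (1 + \<bar>\<omega> k\<bar>) ^ p
        + norm (fourier_coeff g k) * ((1 + \<bar>\<omega> k\<bar>) ^ p / \<bar>\<omega> k\<bar>)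
      \<le> (1 + B) ^ p * (norm (fourier_coeff f k) * N k powr (real p * q))
        + (1 + B) ^ p / b * (norm (fourier_coeff g k) * N k powr ((real p - 1) * q))"
      using mult_left_mono[OF 1, of "norm (fourier_coeff f k)"]
        mult_left_mono[OF 2, of "norm (fourier_coeff g k)"]
      by (simp add: mult.left_commute)
  qed auto
qed

section \<open>Classical differentiability of the solution in time\<close>

text \<open>An infinite sum over a family that is not summable has the default value 0, so the first
  conjunct certifies that \<open>wave_solution\<close> really is the series. Both conjuncts follow
  from one majorant.\<close>

theorem theorem14:
  fixes f g :: "(real ^ 'n::finite \<Rightarrow> complex) \<Rightarrow> complex"
    and \<delta> \<beta> s1 s2 :: real
    and p :: nat
  assumes "\<delta> > 0"
    and "real CARD('n) < \<beta>" and "\<beta> < real CARD('n) + 4"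
    and "f \<in> sobolev_torus s1" and "g \<in> sobolev_torus s2"
    and "s1 \<ge> 0" and "s2 \<ge> 0"
    and "s1 > real CARD('n) + real p * ((\<beta> - real CARD('n)) / 2)"
    and "s2 > real CARD('n) + (real p - 1) * ((\<beta> - real CARD('n)) / 2)"
  shows "\<forall>x\<in>torus.
           (\<forall>t\<ge>0. (\<lambda>k. wave_term \<delta> \<beta> f g x t k) summable_on - {0}) \<and>
           C_k_on p (wave_solution \<delta> \<beta> f g x) {0..}"
proof (intro ballI conjI allI impI)
  fix x :: "real ^ 'n"
  define \<omega> where "\<omega> k = sqrt (- multiplier \<delta> \<beta> (real_vec k))" for k :: "int ^ 'n"
  define M where "M k = norm (fourier_coeff f k) * (1 + \<bar>\<omega> k\<bar>) ^ p
      + norm (fourier_coeff g k) * ((1 + \<bar>\<omega> k\<bar>) ^ p / \<bar>\<omega> k\<bar>)" for k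
  have M: "M summable_on - {0}"
    unfolding M_def \<omega>_def using assms by (intro wave_majorant_summable) auto
  have le: "norm (wave_term_deriv j \<delta> \<beta> f g x k t) \<le> M k" if "j \<le> p" for j k t
    unfolding M_def \<omega>_def by (rule norm_wave_term_deriv_le[OF that])
  show "(\<lambda>k. wave_term \<delta> \<beta> f g x t k) summable_on - {0}" for t
  proof -
    have "(\<lambda>k. norm (wave_term \<delta> \<beta> f g x t k)) summable_on - {0}"
      using le[of 0] by (intro Infinite_Sum.abs_summable_on_comparison_test'[OF M]) (simp add: wave_term_deriv_0)
    then show ?thesis
      by (rule abs_summable_summable)
  qed
  \<comment> \<open>The mode k = 0 stands outside the sum; \<open>L j\<close> is the j-th derivative
    of its affine contribution.\<close>
  define L where "L j t = (if j = 0 then fourier_coeff f 0 + fourier_coeff g 0 * complex_of_real t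
      else if j = 1 then fourier_coeff g 0 else 0)" for j :: nat and t
  define D where "D j t = L j t + (\<Sum>\<^sub>\<infinity>k\<in>- {0}. wave_term_deriv j \<delta> \<beta> f g x k t)" for j t
  have L: "(L j has_vector_derivative L (Suc j) t) (at t within S)" for j t S
  proof -
    have "((\<lambda>t. fourier_coeff f 0 + fourier_coeff g 0 * complex_of_real t) has_vector_derivative
        0 + fourier_coeff g 0 * complex_of_real 1) (at t within S)"
      by (intro has_vector_derivative_add has_vector_derivative_const has_vector_derivative_mult_right
          has_vector_derivative_of_real DERIV_ident)
    then show ?thesis
      unfolding L_def[abs_def] by auto
  qed
  show "C_k_on p (wave_solution \<delta> \<beta> f g x) {0..}"
    unfolding C_k_on_def
  proof (intro exI[of _ D] conjI allI impI ballI)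
    show "D 0 = wave_solution \<delta> \<beta> f g x"
      by (simp add: fun_eq_iff D_def L_def wave_solution_def wave_term_deriv_0)
    fix j
    \<comment> \<open>For \<open>j < p\<close> both orders \<open>j\<close> and \<open>Suc j\<close>
      are at most \<open>p\<close>, so \<open>M\<close> dominates the series and its termwise
      derivative.\<close>
    show "(D j has_vector_derivative D (Suc j) t) (at t within {0..})" if "j < p" "t \<in> {0..}" for t
      unfolding D_def[abs_def]
      using that le
      by (intro has_vector_derivative_add L has_vector_derivative_infsum[OF _ _ _ _ M]
          wave_term_deriv_vector_derivative) auto
    show "continuous_on {0..} (D j)" if "j \<le> p"
    proof -
      \<comment> \<open>The top order \<open>p\<close> has no further derivative to give continuity,
        so continuity is taken from uniform convergence for all orders alike.\<close>
      have "uniform_limit {0..} (\<lambda>X t. \<Sum>k\<in>X. wave_term_deriv j \<delta> \<beta> f g x k t)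
          (\<lambda>t. \<Sum>\<^sub>\<infinity>k\<in>- {0}. wave_term_deriv j \<delta> \<beta> f g x k t) (finite_subsets_at_top (- {0}))"
        using le[OF that] M by (rule Weierstrass_m_test_general)
      then have "continuous_on {0..} (\<lambda>t. \<Sum>\<^sub>\<infinity>k\<in>- {0}. wave_term_deriv j \<delta> \<beta> f g x k t)"
        by (rule uniform_limit_theorem[rotated])
           (auto intro!: always_eventually continuous_on_sum
             continuous_on_vector_derivative[OF wave_term_deriv_vector_derivative])
      moreover have "continuous_on {0..} (L j)"
        by (rule continuous_on_vector_derivative[OF L])
      ultimately show ?thesis
        unfolding D_def[abs_def] by (rule continuous_on_add[rotated])
    qed
  qed
qed

end
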